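(* For every integer $k \geq 3$, there exist $k$-graphs $F_1$ and $F_2$ such that \[ 0 < \gamma^+(F_1, F_2) < \min\{\gamma^+(F_1), \gamma^+(F_2)\}. \]
   Context: For an integer $k\ge 2$, a $k$-graph ($k$-uniform hypergraph) $H$ consists of a (finite) vertex set $V(H)$ and an edge set $E(H)\subseteq\binom{V(H)}{k}$. For a family $\mathcal{F}$ of $k$-graphs, a $k$-graph is $\mathcal{F}$-free if it contains no member of $\mathcal{F}$ as a (not necessarily induced) subgraph. For a $k$-graph $H$ with $E(H)\neq\emptyset$, the minimum positive codegree $\delta^+_{k-1}(H)$ is the minimum, over all $(k-1)$-subsets $S$ of $V(H)$ that are contained in at least one edge of $H$, of the number of edges of $H$ containing $S$; if $E(H)=\emptyset$ then $\delta^+_{k-1}(H):=0$. For a family $\mathcal{F}$ of $k$-graphs, $\mathrm{ex}^+_{k-1}(n,\mathcal{F})$ is the maximum of $\delta^+_{k-1}(H)$ over all $n$-vertex $\mathcal{F}$-free $k$-graphs $H$, and the positive codegree density is $\gamma^+(\mathcal{F}):=\lim_{n\to\infty}\mathrm{ex}^+_{k-1}(n,\mathcal{F})/n$ (the limit is known to exist). Abbreviate $\gamma^+(F):=\gamma^+(\{F\})$ and $\gamma^+(F,H):=\gamma^+(\{F,H\})$. *)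

theory Defs
  imports Complex_Main
begin

datatype 'a hypergraph = Hypergraph (verts: "'a set") (edges: "'a set set")

definition kgraph :: "nat \<Rightarrow> 'a hypergraph \<Rightarrow> bool" where
  "kgraph k H \<longleftrightarrow> finite (verts H) \<and> (\<forall>e\<in>edges H. e \<subseteq> verts H \<and> card e = k)"

definition has_copy :: "'a hypergraph \<Rightarrow> 'b hypergraph \<Rightarrow> bool" where
  "has_copy H F \<longleftrightarrow> (\<exists>f. inj_on f (verts F) \<and> f ` verts F \<subseteq> verts H
      \<and> (\<forall>e\<in>edges F. f ` e \<in> edges H))"

definition free_of :: "'b hypergraph set \<Rightarrow> 'a hypergraph \<Rightarrow> bool" where
  "free_of \<F> H \<longleftrightarrow> (\<forall>F\<in>\<F>. \<not> has_copy H F)"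

definition codegree :: "'a hypergraph \<Rightarrow> 'a set \<Rightarrow> nat" where
  "codegree H S = card {e \<in> edges H. S \<subseteq> e}"

definition min_pos_codegree :: "nat \<Rightarrow> 'a hypergraph \<Rightarrow> nat" where
  "min_pos_codegree k H = (if edges H = {} then 0
     else Min {codegree H S | S. S \<subseteq> verts H \<and> card S = k - 1 \<and> (\<exists>e\<in>edges H. S \<subseteq> e)})"

(* Every finite hypergraph is isomorphic to one on natural numbers, so it suffices to let the
   n-vertex hypergraphs range over that type. *)
definition pos_codegrees :: "nat \<Rightarrow> nat \<Rightarrow> 'b hypergraph set \<Rightarrow> nat set" where
  "pos_codegrees k n \<F> =
     {min_pos_codegree k H | H :: nat hypergraph. kgraph k H \<and> card (verts H) = n \<and> free_of \<F> H}"

(* On nat, Sup of a finite nonempty set is its maximum and Sup {} = 0. The set is always finite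
   (finite_pos_codegrees), and it can be empty only if some member of the family has no edges
   (pos_codegrees_nonempty). *)
definition ex_pos :: "nat \<Rightarrow> nat \<Rightarrow> 'b hypergraph set \<Rightarrow> nat" where
  "ex_pos k n \<F> = Sup (pos_codegrees k n \<F>)"

definition pos_codegree_density :: "nat \<Rightarrow> 'b hypergraph set \<Rightarrow> real" where
  "pos_codegree_density k \<F> = lim (\<lambda>n. real (ex_pos k n \<F>) / real n)"

lemma min_pos_codegree_le:
  assumes H: "kgraph k H"
  shows "min_pos_codegree k H \<le> 2 ^ card (verts H)"
proof (cases "edges H = {}")
  case True
  then show ?thesis by (simp add: min_pos_codegree_def)
next
  case False
  let ?A = "{codegree H S | S. S \<subseteq> verts H \<and> card S = k - 1 \<and> (\<exists>e\<in>edges H. S \<subseteq> e)}"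
  have fin: "finite (verts H)" and sub: "edges H \<subseteq> Pow (verts H)"
    using H by (auto simp: kgraph_def)
  have bound: "codegree H S \<le> 2 ^ card (verts H)" for S
    unfolding codegree_def using card_mono[of "Pow (verts H)" "{e \<in> edges H. S \<subseteq> e}"] fin sub
    by (auto simp: card_Pow)
  have "finite ?A"
    by (rule finite_subset[of _ "{..2 ^ card (verts H)}"]) (use bound in auto)
  moreover obtain e where e: "e \<in> edges H" using False by blast
  with H have "card e = k" "e \<subseteq> verts H" by (auto simp: kgraph_def)
  then obtain S where "S \<subseteq> e" "card S = k - 1"
    by (metis diff_le_self obtain_subset_with_card_n)
  then have "codegree H S \<in> ?A" using e \<open>e \<subseteq> verts H\<close> by blast
  ultimately have "Min ?A \<le> codegree H S" by (rule Min_le)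
  then show ?thesis using bound[of S] False by (simp add: min_pos_codegree_def)
qed

lemma finite_pos_codegrees: "finite (pos_codegrees k n \<F>)"
  by (rule finite_subset[of _ "{..2 ^ n}"])
    (auto simp: pos_codegrees_def dest: min_pos_codegree_le)

lemma pos_codegrees_nonempty:
  assumes "\<And>F. F \<in> \<F> \<Longrightarrow> edges F \<noteq> {}"
  shows "pos_codegrees k n \<F> \<noteq> {}"
proof -
  have "min_pos_codegree k (Hypergraph {..<n} {}) \<in> pos_codegrees k n \<F>"
    unfolding pos_codegrees_def
    by (rule CollectI, rule exI[of _ "Hypergraph {..<n} {}"])
      (use assms in \<open>auto simp: kgraph_def free_of_def has_copy_def\<close>)
  then show ?thesis by blast
qed

end

theory Submission imports Defs begin

text \<open>Take for F1 the complete k-graph on k + 1 vertices and for F2 the expansion of the complete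
  graph on k + 2 vertices: every pair of core vertices lies in an edge whose other k - 2 vertices are
  private to it. Blow-ups of a single edge avoid both, blow-ups of F1 avoid F2 and have density
  2/(k + 1), and blow-ups of a two-part construction avoid F1 and have density 5/(k + 8). On the other
  hand, a k-graph without F1 whose shadow has no clique of size k + 2 has positive codegree at most
  2(k - 1)/k^2 times the number of vertices, by counting extensions of (k - 1)-subsets of a (k + 1)-set
  that spans as many edges as possible. This is smaller than both densities. For large positive
  codegree, F2-freeness is a condition on the shadow only, hence is inherited by blow-ups; this also
  gives the existence of the limits.\<close>

section \<open>Positive codegree counted by extending vertices\<close>

definition extensions :: "'a hypergraph \<Rightarrow> 'a set \<Rightarrow> 'a set" where
  "extensions H S = {y. y \<notin> S \<and> insert y S \<in> edges H}"

text \<open>A threshold form without \<open>Min\<close>, to be verified set by set. It holds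
  vacuously in an edgeless hypergraph, where \<open>min_pos_codegree\<close> is 0 by
  convention.\<close>

definition pos_codegree_ge :: "nat \<Rightarrow> 'a hypergraph \<Rightarrow> nat \<Rightarrow> bool" where
  "pos_codegree_ge k H d \<longleftrightarrow>
     (\<forall>S e. card S = k - 1 \<longrightarrow> e \<in> edges H \<longrightarrow> S \<subseteq> e \<longrightarrow> d \<le> card (extensions H S))"

text \<open>Homomorphisms replace copies because a copy in a blow-up projects only to a homomorphism
  into the original.\<close>

definition hom :: "'b hypergraph \<Rightarrow> 'a hypergraph \<Rightarrow> ('b \<Rightarrow> 'a) \<Rightarrow> bool" where
  "hom F H f \<longleftrightarrow> (\<forall>e\<in>edges F. f ` e \<in> edges H)"

text \<open>For distinct vertices this is adjacency in the shadow graph of \<open>H\<close>.\<close>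

definition covered :: "'a hypergraph \<Rightarrow> 'a \<Rightarrow> 'a \<Rightarrow> bool" where
  "covered H x y \<longleftrightarrow> (\<exists>e\<in>edges H. x \<in> e \<and> y \<in> e)"

lemma kgraphD:
  assumes "kgraph k H" "e \<in> edges H"
  shows "e \<subseteq> verts H" "card e = k" "finite e"
  using assms by (auto simp: kgraph_def intro: finite_subset)

lemma extensions_subset:
  assumes "kgraph k H"
  shows "extensions H S \<subseteq> verts H" "finite (extensions H S)"
proof -
  show "extensions H S \<subseteq> verts H"
    using assms by (auto simp: extensions_def kgraph_def)
  then show "finite (extensions H S)"
    using assms by (auto simp: kgraph_def intro: finite_subset)
qed

lemma codegree_eq_card_extensions:
  assumes H: "kgraph k H" and k: "k \<ge> 1" and S: "finite S" "card S = k - 1"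
  shows "codegree H S = card (extensions H S)"
proof -
  have "{e \<in> edges H. S \<subseteq> e} = (\<lambda>y. insert y S) ` extensions H S"
  proof (intro equalityI subsetI)
    fix e assume e: "e \<in> {e \<in> edges H. S \<subseteq> e}"
    then have "card e = k" "finite e" using H kgraphD by auto
    then have "card (e - S) = 1" using e S k by (simp add: card_Diff_subset)
    then obtain y where "e - S = {y}" by (auto simp: card_1_singleton_iff)
    then have "e = insert y S" "y \<notin> S" using e by auto
    then show "e \<in> (\<lambda>y. insert y S) ` extensions H S"
      using e by (auto simp: extensions_def)
  qed (auto simp: extensions_def)
  moreover have "inj_on (\<lambda>y. insert y S) (extensions H S)"
    by (auto simp: inj_on_def extensions_def)
  ultimately show ?thesis by (simp add: codegree_def card_image)
qed

lemma finite_codegrees: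
  assumes H: "kgraph k H"
  shows "finite {codegree H S | S. S \<subseteq> verts H \<and> card S = k - 1 \<and> (\<exists>e\<in>edges H. S \<subseteq> e)}"
proof -
  have "finite (Pow (verts H))" using H by (simp add: kgraph_def)
  then have "finite (codegree H ` Pow (verts H))" by blast
  then show ?thesis by (rule rev_finite_subset) auto
qed

lemma pos_codegree_ge_min:
  assumes H: "kgraph k H" and k: "k \<ge> 1"
  shows "pos_codegree_ge k H (min_pos_codegree k H)"
  unfolding pos_codegree_ge_def
proof (intro allI impI)
  fix S e assume S: "card S = k - 1" "e \<in> edges H" "S \<subseteq> e"
  have fin: "finite S" "S \<subseteq> verts H" using S kgraphD[OF H] by (auto intro: finite_subset)
  have "Min {codegree H S | S. S \<subseteq> verts H \<and> card S = k - 1 \<and> (\<exists>e\<in>edges H. S \<subseteq> e)} \<le> codegree H S"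
    by (rule Min_le[OF finite_codegrees[OF H]]) (use S fin in blast)
  then have "min_pos_codegree k H \<le> codegree H S"
    using S by (auto simp: min_pos_codegree_def)
  then show "min_pos_codegree k H \<le> card (extensions H S)"
    using codegree_eq_card_extensions[OF H k] S fin by simp
qed

text \<open>The assumption \<open>ne\<close> excludes the edgeless case, where the vacuous bound
  \<open>d\<close> may exceed the default value 0.\<close>

lemma le_min_pos_codegree:
  assumes H: "kgraph k H" and k: "k \<ge> 1" and ne: "edges H \<noteq> {}"
    and d: "pos_codegree_ge k H d"
  shows "d \<le> min_pos_codegree k H"
proof -
  let ?A = "{codegree H S | S. S \<subseteq> verts H \<and> card S = k - 1 \<and> (\<exists>e\<in>edges H. S \<subseteq> e)}"
  obtain e where e: "e \<in> edges H" using ne by blast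
  with H have "card e = k" "e \<subseteq> verts H" by (auto simp: kgraph_def)
  then obtain S where "S \<subseteq> e" "card S = k - 1"
    by (metis diff_le_self obtain_subset_with_card_n)
  then have "?A \<noteq> {}" using e \<open>e \<subseteq> verts H\<close> by blast
  moreover have "d \<le> a" if "a \<in> ?A" for a
  proof -
    obtain S e where S: "a = codegree H S" "card S = k - 1" "e \<in> edges H" "S \<subseteq> e"
      using \<open>a \<in> ?A\<close> by auto
    then have "finite S" using kgraphD[OF H] finite_subset by blast
    then show ?thesis
      using S d codegree_eq_card_extensions[OF H k] unfolding pos_codegree_ge_def by metis
  qed
  ultimately have "d \<le> Min ?A"
    using finite_codegrees[OF H] by simp
  then show ?thesis using ne by (simp add: min_pos_codegree_def)
qed

lemma pos_codegree_ge_le_card: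
  assumes H: "kgraph k H" and ne: "edges H \<noteq> {}" and d: "pos_codegree_ge k H d"
  shows "d \<le> card (verts H)"
proof -
  obtain e where e: "e \<in> edges H" using ne by blast
  then have "card e = k" using H by (auto simp: kgraph_def)
  then obtain S where "S \<subseteq> e" "card S = k - 1"
    by (metis diff_le_self obtain_subset_with_card_n)
  then have "d \<le> card (extensions H S)" using d e by (auto simp: pos_codegree_ge_def)
  also have "\<dots> \<le> card (verts H)"
    using H extensions_subset[OF H] by (intro card_mono) (auto simp: kgraph_def)
  finally show ?thesis .
qed

subsection \<open>Blow-ups\<close>

text \<open>The classes are the fibres of \<open>\<phi>\<close>, which may differ in size;
  injectivity lets an edge use each class at most once.\<close>

definition blowup :: "'a hypergraph \<Rightarrow> ('b \<Rightarrow> 'a) \<Rightarrow> 'b set \<Rightarrow> 'b hypergraph" where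
  "blowup H \<phi> V = Hypergraph V {e. e \<subseteq> V \<and> inj_on \<phi> e \<and> \<phi> ` e \<in> edges H}"

lemma kgraph_blowup:
  assumes "kgraph k H" "finite V"
  shows "kgraph k (blowup H \<phi> V)"
  using assms by (auto simp: kgraph_def blowup_def card_image[symmetric])

text \<open>Every vertex extending the projection of \<open>S\<close> contributes its whole fibre;
  the fibres are disjoint and have at least \<open>t\<close> vertices each.\<close>

lemma pos_codegree_ge_blowup:
  assumes H: "kgraph k H" and V: "finite V" and d: "pos_codegree_ge k H d"
    and t: "\<And>x. x \<in> verts H \<Longrightarrow> t \<le> card {v \<in> V. \<phi> v = x}"
  shows "pos_codegree_ge k (blowup H \<phi> V) (t * d)"
  unfolding pos_codegree_ge_def
proof (intro allI impI)
  fix S e assume S: "card S = k - 1" and e: "e \<in> edges (blowup H \<phi> V)" and Se: "S \<subseteq> e"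
  from e have e': "e \<subseteq> V" "inj_on \<phi> e" "\<phi> ` e \<in> edges H" by (auto simp: blowup_def)
  have inj: "inj_on \<phi> S" using e'(2) Se by (rule inj_on_subset)
  let ?Y = "extensions H (\<phi> ` S)"
  have "card (\<phi> ` S) = k - 1" using inj S by (simp add: card_image)
  then have "d \<le> card ?Y" using d e' Se unfolding pos_codegree_ge_def by (meson image_mono)
  then have "t * d \<le> (\<Sum>y\<in>?Y. t)" by (simp add: mult.commute)
  also have "\<dots> \<le> (\<Sum>y\<in>?Y. card {v \<in> V. \<phi> v = y})"
    using t extensions_subset[OF H] by (intro sum_mono) blast
  also have "\<dots> = card (\<Union>y\<in>?Y. {v \<in> V. \<phi> v = y})"
    using extensions_subset[OF H] V by (subst card_UN_disjoint) auto
  also have "\<dots> \<le> card (extensions (blowup H \<phi> V) S)"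
  proof (rule card_mono)
    show "finite (extensions (blowup H \<phi> V) S)"
      using extensions_subset(2)[OF kgraph_blowup[OF H V]] .
    show "(\<Union>y\<in>?Y. {v \<in> V. \<phi> v = y}) \<subseteq> extensions (blowup H \<phi> V) S"
      using Se e'(1) inj by (auto simp: extensions_def blowup_def)
  qed
  finally show "t * d \<le> card (extensions (blowup H \<phi> V) S)" .
qed

lemma has_copy_blowup_imp_hom:
  assumes "has_copy (blowup H \<phi> V) F"
  shows "\<exists>f. hom F H f"
proof -
  obtain f where "\<forall>e\<in>edges F. f ` e \<in> edges (blowup H \<phi> V)"
    using assms by (auto simp: has_copy_def)
  then have "hom F H (\<phi> \<circ> f)" by (auto simp: hom_def blowup_def image_comp)
  then show ?thesis by blast
qed

lemma card_residue_class_ge: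
  fixes n :: nat
  assumes "i < n"
  shows "N div n \<le> card {v \<in> {..<N}. v mod n = i}"
proof -
  let ?f = "\<lambda>j. j * n + i"
  have "inj_on ?f {..<N div n}" using assms by (auto simp: inj_on_def)
  moreover have "?f ` {..<N div n} \<subseteq> {v \<in> {..<N}. v mod n = i}"
  proof clarsimp
    fix j assume "j < N div n"
    then have "Suc j * n \<le> N div n * n" by (intro mult_right_mono) auto
    also have "\<dots> \<le> N" by simp
    finally show "j * n + i < N \<and> i mod n = i" using assms by simp
  qed
  then have "card (?f ` {..<N div n}) \<le> card {v \<in> {..<N}. v mod n = i}"
    by (intro card_mono) auto
  ultimately show ?thesis by (simp add: card_image)
qed

lemma ex_pos_ge_of_member:
  assumes "kgraph k (H :: nat hypergraph)" "free_of \<F> H"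
  shows "min_pos_codegree k H \<le> ex_pos k (card (verts H)) \<F>"
  unfolding ex_pos_def
  by (rule cSup_upper)
    (use assms in \<open>auto simp: pos_codegrees_def intro!: bdd_above_finite finite_pos_codegrees[unfolded pos_codegrees_def]\<close>)

text \<open>Distributing \<open>N\<close> vertices by residue makes all classes of size at least
  \<open>N div card (verts H)\<close>. The absence of homomorphisms into \<open>H\<close> keeps this
  blow-up free.\<close>

lemma ex_pos_ge_blowup:
  fixes H :: "nat hypergraph"
  assumes H: "kgraph k H" and k: "k \<ge> 1" and ne: "edges H \<noteq> {}"
    and d: "pos_codegree_ge k H d" and free: "\<And>F f. F \<in> \<F> \<Longrightarrow> \<not> hom F H f"
  shows "(N div card (verts H)) * d \<le> ex_pos k N \<F>"
proof (cases "N div card (verts H) = 0")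
  case False
  let ?n = "card (verts H)"
  obtain h where h: "bij_betw h {0..<?n} (verts H)"
    using ex_bij_betw_nat_finite[of "verts H"] H by (metis kgraph_def)
  define \<phi> where "\<phi> v = h (v mod ?n)" for v
  let ?B = "blowup H \<phi> {..<N}"
  have n: "?n > 0" using False by (metis div_by_0 gr0I)
  have fib: "N div ?n \<le> card {v \<in> {..<N}. \<phi> v = x}" if x: "x \<in> verts H" for x
  proof -
    obtain i where i: "i < ?n" "x = h i"
      using h x by (metis atLeastLessThan_iff bij_betw_imp_surj_on imageE)
    have "{v \<in> {..<N}. v mod ?n = i} \<subseteq> {v \<in> {..<N}. \<phi> v = x}"
      using i by (auto simp: \<phi>_def)
    then have "card {v \<in> {..<N}. v mod ?n = i} \<le> card {v \<in> {..<N}. \<phi> v = x}"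
      by (intro card_mono) auto
    then show ?thesis using card_residue_class_ge[OF i(1), of N] by simp
  qed
  have surj: "\<exists>v. v < N \<and> \<phi> v = x" if "x \<in> verts H" for x
    using fib[OF that] False card.empty
    by (metis (mono_tags, lifting) Collect_empty_eq le_zero_eq lessThan_iff)
  have kB: "kgraph k ?B" by (rule kgraph_blowup[OF H]) simp
  \<comment> \<open>In this case every class is nonempty, so an edge of \<open>H\<close> lifts by
    choosing one representative per vertex.\<close>
  have "edges ?B \<noteq> {}"
  proof -
    obtain e where e: "e \<in> edges H" using ne by blast
    then have "\<forall>x\<in>e. \<exists>v. v < N \<and> \<phi> v = x" using surj kgraphD[OF H] by blast
    then obtain g where g: "\<forall>x\<in>e. g x < N \<and> \<phi> (g x) = x" by metis
    then have "\<phi> ` g ` e = e" by force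
    moreover have "inj_on \<phi> (g ` e)" using g by (auto simp: inj_on_def)
    ultimately have "g ` e \<in> edges ?B" using g e by (auto simp: blowup_def)
    then show ?thesis by blast
  qed
  moreover have "pos_codegree_ge k ?B (N div ?n * d)"
    using fib by (intro pos_codegree_ge_blowup[OF H _ d]) auto
  ultimately have "N div ?n * d \<le> min_pos_codegree k ?B"
    by (intro le_min_pos_codegree[OF kB k])
  also have "\<dots> \<le> ex_pos k (card (verts ?B)) \<F>"
    using free has_copy_blowup_imp_hom kB
    by (intro ex_pos_ge_of_member) (fastforce simp: free_of_def)+
  also have "card (verts ?B) = N" by (simp add: blowup_def)
  finally show ?thesis .
qed simp

text \<open>The edgeless hypergraph avoids such a family, so the supremum runs over a nonempty
  finite set and is a maximum.\<close>

lemma ex_pos_attained: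
  assumes "\<And>F. F \<in> \<F> \<Longrightarrow> edges F \<noteq> {}"
  obtains H :: "nat hypergraph" where "kgraph k H" "card (verts H) = n" "free_of \<F> H"
    "ex_pos k n \<F> = min_pos_codegree k H"
proof -
  have ne: "pos_codegrees k n \<F> \<noteq> {}" using assms by (rule pos_codegrees_nonempty)
  then have "ex_pos k n \<F> \<in> pos_codegrees k n \<F>"
    unfolding ex_pos_def using Max_in[OF finite_pos_codegrees ne]
    by (simp add: cSup_eq_Max[OF finite_pos_codegrees ne])
  then show ?thesis using that by (auto simp: pos_codegrees_def)
qed

subsection \<open>Hypergraphs with a covered core\<close>

text \<open>A common form for both forbidden hypergraphs: the vertices below \<open>c\<close> are
  the core, and each later vertex is private to one edge. A complete hypergraph has no private
  vertices.\<close>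

definition cored :: "nat \<Rightarrow> nat \<Rightarrow> nat hypergraph \<Rightarrow> bool" where
  "cored k c F \<longleftrightarrow> kgraph k F \<and>
     (\<exists>N\<ge>c. verts F = {..<N} \<and> (\<forall>v\<in>{c..<N}. \<exists>!e. e \<in> edges F \<and> v \<in> e)) \<and>
     (\<forall>i<c. \<forall>j<c. i \<noteq> j \<longrightarrow> covered F i j)"

lemma cored_covered:
  assumes "cored k c F" "i < c" "j < c" "i \<noteq> j"
  shows "covered F i j"
  using assms by (simp add: cored_def)

text \<open>A vertex lying in only one edge can be placed greedily: the already embedded part of that
  edge extends to a (k-1)-set of positive codegree.\<close>

lemma has_copy_of_core:
  assumes F: "cored k c F" and k: "k \<ge> 1" and H: "kgraph k H"
    and d: "pos_codegree_ge k H (card (verts F))"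
    and f: "inj_on f {..<c}" "f ` {..<c} \<subseteq> verts H"
    and fe: "\<And>e. e \<in> edges F \<Longrightarrow> \<exists>h\<in>edges H. f ` (e \<inter> {..<c}) \<subseteq> h"
  shows "has_copy H F"
proof -
  obtain N where N: "c \<le> N" "verts F = {..<N}"
    and uniq: "\<And>v. c \<le> v \<Longrightarrow> v < N \<Longrightarrow> \<exists>!e. e \<in> edges F \<and> v \<in> e"
    using F by (auto simp: cored_def)
  have kF: "kgraph k F" using F by (simp add: cored_def)
  \<comment> \<open>Invariant of the greedy embedding: the placed part of every edge lies inside
    some edge of \<open>H\<close>.\<close>
  have "\<exists>g. inj_on g {..<v} \<and> g ` {..<v} \<subseteq> verts H \<and>
      (\<forall>e\<in>edges F. \<exists>h\<in>edges H. g ` (e \<inter> {..<v}) \<subseteq> h)" if "c \<le> v" "v \<le> N" for v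
    using that
  proof (induction v rule: dec_induct)
    case base
    then show ?case using f fe by blast
  next
    case (step v)
    then obtain g where g: "inj_on g {..<v}" "g ` {..<v} \<subseteq> verts H"
      "\<And>e. e \<in> edges F \<Longrightarrow> \<exists>h\<in>edges H. g ` (e \<inter> {..<v}) \<subseteq> h"
      by auto
    obtain e where e: "e \<in> edges F" "v \<in> e" and e_uniq: "\<And>e'. e' \<in> edges F \<Longrightarrow> v \<in> e' \<Longrightarrow> e' = e"
      using uniq[of v] step by auto
    obtain h where h: "h \<in> edges H" "g ` (e \<inter> {..<v}) \<subseteq> h" using g(3) e by blast
    have fe: "finite e" "card e = k" using kgraphD[OF kF e(1)] by auto
    have "card (g ` (e \<inter> {..<v})) \<le> card (e \<inter> {..<v})" by (intro card_image_le) auto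
    also have "\<dots> \<le> card (e - {v})" using fe by (intro card_mono) auto
    also have "\<dots> = k - 1" using fe e by simp
    finally have "card (g ` (e \<inter> {..<v})) \<le> k - 1" .
    moreover have "card h = k" "finite h" using kgraphD[OF H h(1)] by auto
    ultimately obtain S where S: "g ` (e \<inter> {..<v}) \<subseteq> S" "S \<subseteq> h" "card S = k - 1"
      using exists_subset_between[of "g ` (e \<inter> {..<v})" "k - 1" h] h by auto
    \<comment> \<open>Fewer than \<open>N\<close> vertices have been used, so one of the extensions
      of \<open>S\<close> is still fresh.\<close>
    have "N \<le> card (extensions H S)"
      using d S h N unfolding pos_codegree_ge_def by auto
    then have "card (g ` {..<v}) < card (extensions H S)"
      using step card_image_le[of "{..<v}" g] by simp
    then obtain y where y: "y \<in> extensions H S" "y \<notin> g ` {..<v}"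
      using card_mono[of "g ` {..<v}" "extensions H S"] by (meson finite_imageI finite_lessThan linorder_not_le subsetI)
    define g' where "g' = g(v := y)"
    have "{..<Suc v} = insert v {..<v}" by auto
    have img: "g' ` A = g ` A" if "v \<notin> A" for A
      unfolding g'_def using that by (auto simp: image_iff)
    have "inj_on g' {..<Suc v}"
      using g(1) y(2) by (auto simp: g'_def inj_on_def less_Suc_eq image_iff)
    moreover have "g' ` {..<Suc v} \<subseteq> verts H"
      using g(2) y(1) extensions_subset[OF H] by (auto simp: g'_def less_Suc_eq)
    moreover have "\<exists>h\<in>edges H. g' ` (e' \<inter> {..<Suc v}) \<subseteq> h" if e': "e' \<in> edges F" for e'
    proof (cases "v \<in> e'")
      case True
      then have [simp]: "e' = e" using e_uniq e' by blast
      have "e \<inter> {..<Suc v} = insert v (e \<inter> {..<v})" using e by auto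
      then have "g' ` (e \<inter> {..<Suc v}) = insert y (g ` (e \<inter> {..<v}))"
        by (simp add: img) (simp add: g'_def)
      also have "\<dots> \<subseteq> insert y S" using S by blast
      finally show ?thesis using y by (auto simp: extensions_def)
    next
      case False
      then have "e' \<inter> {..<Suc v} = e' \<inter> {..<v}" by (auto simp: less_Suc_eq)
      then show ?thesis using img[of "e' \<inter> {..<v}"] g(3)[OF e'] False by auto
    qed
    ultimately show ?case by blast
  qed
  from this[of N] N obtain g where g: "inj_on g {..<N}" "g ` {..<N} \<subseteq> verts H"
    "\<forall>e\<in>edges F. \<exists>h\<in>edges H. g ` (e \<inter> {..<N}) \<subseteq> h" by auto
  have "g ` e \<in> edges H" if e: "e \<in> edges F" for e
  proof -
    have eN: "e \<subseteq> {..<N}" "card e = k" using kgraphD[OF kF e] N by auto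
    then have "e \<inter> {..<N} = e" by blast
    then obtain h where h: "h \<in> edges H" "g ` e \<subseteq> h" using g e by metis
    \<comment> \<open>Once all vertices are placed, the image of \<open>e\<close> has full size
      \<open>k\<close>, so containment in \<open>h\<close> becomes equality.\<close>
    have "card (g ` e) = k" using eN g(1) by (simp add: card_image inj_on_subset)
    then have "g ` e = h" using kgraphD[OF H h(1)] h(2) by (simp add: card_subset_eq)
    then show ?thesis using h by simp
  qed
  then show ?thesis using g N by (auto simp: has_copy_def)
qed

text \<open>Two core vertices share an edge, and the image of that edge still has \<open>k\<close>
  vertices, so they cannot be identified.\<close>

lemma cored_hom_inj:
  assumes F: "cored k c F" and H: "kgraph k H" and f: "hom F H f"
  shows "inj_on f {..<c}"
proof (rule inj_onI, rule ccontr)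
  fix i j assume ij: "i \<in> {..<c}" "j \<in> {..<c}" "f i = f j" "i \<noteq> j"
  then obtain e where e: "e \<in> edges F" "i \<in> e" "j \<in> e"
    using cored_covered[OF F] unfolding covered_def by blast
  have "finite e" "card e = k" using F e kgraphD[of k F e] by (auto simp: cored_def)
  moreover have "card (f ` e) = k" using f e kgraphD[OF H] by (auto simp: hom_def)
  ultimately have "inj_on f e" by (simp add: eq_card_imp_inj_on)
  then show False using ij e by (auto simp: inj_on_def)
qed

lemma cored_hom_verts:
  assumes F: "cored k c F" and c: "c \<ge> 2" and H: "kgraph k H" and f: "hom F H f"
  shows "f ` {..<c} \<subseteq> verts H"
proof clarify
  fix i assume "i < c"
  moreover obtain j where "j < c" "j \<noteq> i" using c
    by (metis One_nat_def Suc_1 Suc_le_lessD less_trans zero_less_Suc nat_less_le zero_neq_one)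
  ultimately obtain e where "e \<in> edges F" "i \<in> e"
    using cored_covered[OF F] unfolding covered_def by blast
  then show "f i \<in> verts H" using f kgraphD[OF H] by (fastforce simp: hom_def)
qed

text \<open>The core is mapped injectively, so it does not fit into fewer than \<open>c\<close>
  vertices.\<close>

lemma cored_no_hom_small:
  assumes "cored k c F" "c \<ge> 2" "kgraph k H" "card (verts H) < c"
  shows "\<not> hom F H f"
proof
  assume f: "hom F H f"
  have "card (f ` {..<c}) = c" using cored_hom_inj[OF assms(1,3) f] by (simp add: card_image)
  moreover have "card (f ` {..<c}) \<le> card (verts H)"
    using cored_hom_verts[OF assms(1-3) f] assms(3) by (intro card_mono) (auto simp: kgraph_def)
  ultimately show False using assms by simp
qed

text \<open>A homomorphism may identify private vertices. Only its restriction to the core is kept;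
  the private vertices are embedded afresh.\<close>

lemma cored_hom_imp_has_copy:
  assumes F: "cored k c F" and c: "c \<ge> 2" and k: "k \<ge> 1" and H: "kgraph k H"
    and d: "pos_codegree_ge k H (card (verts F))" and f: "hom F H f"
  shows "has_copy H F"
  using has_copy_of_core[OF F k H d cored_hom_inj[OF F H f] cored_hom_verts[OF F c H f]] f
  by (auto simp: hom_def)

lemma cored_edges_nonempty:
  assumes "cored k c F" "c \<ge> 2"
  shows "edges F \<noteq> {}"
proof -
  have "covered F 0 1" using assms by (simp add: cored_def)
  then show ?thesis by (auto simp: covered_def)
qed

subsection \<open>Existence of the density\<close>

text \<open>Rounding down changes \<open>N / n\<close> by less than 1, which vanishes after division
  by \<open>N\<close>.\<close>

lemma div_mult_tendsto:
  assumes n: "n > 0"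
  shows "(\<lambda>N. real (N div n * d) / real N) \<longlonglongrightarrow> real d / real n"
proof (rule tendsto_sandwich)
  show "\<forall>\<^sub>F N in sequentially. (1 / real n - 1 / real N) * real d \<le> real (N div n * d) / real N"
  proof (rule eventually_sequentiallyI[of 1])
    fix N :: nat assume N: "1 \<le> N"
    have "N = N div n * n + N mod n" by simp
    also have "\<dots> \<le> N div n * n + n"
      using n by (intro add_left_mono less_imp_le mod_less_divisor)
    finally have "real N \<le> real (N div n) * real n + real n"
      by (metis of_nat_add of_nat_le_iff of_nat_mult)
    then have "(real N - real n) / (real n * real N) \<le> real (N div n) * real n / (real n * real N)"
      by (intro divide_right_mono) auto
    then have "1 / real n - 1 / real N \<le> real (N div n) / real N"
      using n N by (simp add: diff_divide_distrib)
    then have "(1 / real n - 1 / real N) * real d \<le> real (N div n) / real N * real d"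
      by (rule mult_right_mono) simp
    then show "(1 / real n - 1 / real N) * real d \<le> real (N div n * d) / real N" by simp
  qed
  show "\<forall>\<^sub>F N in sequentially. real (N div n * d) / real N \<le> real d / real n"
  proof (rule eventually_sequentiallyI[of 1])
    fix N :: nat assume N: "1 \<le> N"
    have "real (N div n) * real n \<le> real N"
      by (metis div_times_less_eq_dividend of_nat_le_iff of_nat_mult)
    then have "real (N div n) / real N \<le> 1 / real n"
      using n N by (simp add: field_simps)
    then have "real (N div n) / real N * real d \<le> 1 / real n * real d"
      by (rule mult_right_mono) simp
    then show "real (N div n * d) / real N \<le> real d / real n" by simp
  qed
  show "(\<lambda>N. (1 / real n - 1 / real N) * real d) \<longlonglongrightarrow> real d / real n"
  proof -
    have "(\<lambda>N. (1 / real n - 1 / real N) * real d) \<longlonglongrightarrow> (1 / real n - 0) * real d"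
      by (intro tendsto_intros lim_1_over_n)
    then show ?thesis by simp
  qed
qed simp

text \<open>A Fekete-type argument: the limit is the supremum of the quotients, since each quotient
  is asymptotically a lower bound for all later ones.\<close>

lemma convergent_of_div_superadditive:
  fixes a :: "nat \<Rightarrow> nat"
  assumes le: "\<And>n. n \<ge> n0 \<Longrightarrow> a n \<le> n"
    and sup: "\<And>n N. n \<ge> n0 \<Longrightarrow> N div n * a n \<le> a N"
  shows "convergent (\<lambda>n. real (a n) / real n)"
proof -
  \<comment> \<open>The successor keeps denominators positive even when \<open>n0\<close> is
    0.\<close>
  define n1 where "n1 = Suc n0"
  define L where "L = (SUP n\<in>{n1..}. real (a n) / real n)"
  have bdd: "bdd_above ((\<lambda>n. real (a n) / real n) ` {n1..})"
    by (rule bdd_aboveI2[of _ _ 1]) (use le in \<open>auto simp: n1_def divide_le_eq_1\<close>)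
  have "(\<lambda>n. real (a n) / real n) \<longlonglongrightarrow> L"
  proof (rule order_tendstoI)
    fix y assume "y < L"
    then obtain n where n: "n \<ge> n1" "y < real (a n) / real n"
      unfolding L_def using less_cSUP_iff[OF _ bdd] by auto
    then have "\<forall>\<^sub>F N in sequentially. y < real (N div n * a n) / real N"
      using order_tendstoD(1)[OF div_mult_tendsto] by (simp add: n1_def)
    then show "\<forall>\<^sub>F N in sequentially. y < real (a N) / real N"
    proof eventually_elim
      case (elim N)
      also have "real (N div n * a n) / real N \<le> real (a N) / real N"
        using sup[of n N] n by (intro divide_right_mono) (auto simp: n1_def simp del: of_nat_mult)
      finally show ?case .
    qed
  next
    fix y assume "L < y"
    moreover have "real (a n) / real n \<le> L" if "n \<ge> n1" for n
      unfolding L_def using bdd that by (intro cSUP_upper) auto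
    ultimately show "\<forall>\<^sub>F N in sequentially. real (a N) / real N < y"
      by (intro eventually_sequentiallyI[of n1]) (meson le_less_trans)
  qed
  then show ?thesis by (rule convergentI)
qed

definition clique :: "nat \<Rightarrow> nat \<Rightarrow> nat hypergraph" where
  "clique k r = Hypergraph {..<r} {e. e \<subseteq> {..<r} \<and> card e = k}"

lemma kgraph_clique: "kgraph k (clique k r)"
  by (auto simp: kgraph_def clique_def)

lemma edges_clique_nonempty:
  assumes "k \<le> r"
  shows "edges (clique k r) \<noteq> {}"
proof -
  have "{..<k} \<in> edges (clique k r)" using assms by (auto simp: clique_def)
  then show ?thesis by blast
qed

lemma pos_codegree_ge_clique:
  assumes k: "1 \<le> k"
  shows "pos_codegree_ge k (clique k r) (r - k + 1)"
  unfolding pos_codegree_ge_def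
proof (intro allI impI)
  fix S e assume S: "card S = k - 1" and e: "e \<in> edges (clique k r)" "S \<subseteq> e"
  have er: "e \<subseteq> {..<r}" "card e = k" using e by (auto simp: clique_def)
  then have S': "S \<subseteq> {..<r}" "finite S" using e by (auto intro: finite_subset)
  have "k \<le> r" using er card_mono[of "{..<r}" e] by simp
  have "{..<r} - S \<subseteq> extensions (clique k r) S"
    using S S' k by (auto simp: extensions_def clique_def)
  then have "card ({..<r} - S) \<le> card (extensions (clique k r) S)"
    using extensions_subset[OF kgraph_clique] by (intro card_mono)
  moreover have "card ({..<r} - S) = r - (k - 1)" using S S' by (simp add: card_Diff_subset)
  ultimately show "r - k + 1 \<le> card (extensions (clique k r) S)" using k \<open>k \<le> r\<close> by simp
qed

text \<open>For a cored graph, a homomorphism into a hypergraph of large positive codegree yields a copy;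
  hence blow-ups of large free hypergraphs of positive codegree stay free.\<close>

lemma convergent_ex_pos_cored:
  assumes k: "k \<ge> 2" and fin: "finite \<F>"
    and cored: "\<And>F. F \<in> \<F> \<Longrightarrow> \<exists>c>k. cored k c F"
  shows "convergent (\<lambda>n. real (ex_pos k n \<F>) / real n)"
proof -
  \<comment> \<open>Positive codegree \<open>C\<close> suffices for embedding every member greedily.
    The summand 1 makes \<open>C\<close> positive, so reaching it forces an edge.\<close>
  define C where "C = (\<Sum>F\<in>\<F>. card (verts F)) + 1"
  have ne: "edges F \<noteq> {}" if "F \<in> \<F>" for F
    using cored[OF that] cored_edges_nonempty k by (meson less_imp_le order_trans)
  have ge: "n div k \<le> ex_pos k n \<F>" for n
  proof -
    \<comment> \<open>Blow-ups of a single edge: \<open>k\<close> vertices are too few for any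
      core.\<close>
    have "n div card (verts (clique k k)) * (k - k + 1) \<le> ex_pos k n \<F>"
    proof (rule ex_pos_ge_blowup[OF kgraph_clique])
      fix F f assume "F \<in> \<F>"
      then obtain c where "c > k" "cored k c F" using cored by blast
      then show "\<not> hom F (clique k k) f"
        using k by (intro cored_no_hom_small[OF _ _ kgraph_clique]) (auto simp: clique_def)
    qed (use k edges_clique_nonempty pos_codegree_ge_clique[of k k] in auto)
    then show ?thesis by (simp add: clique_def)
  qed
  have large: "C \<le> ex_pos k n \<F>" if "n \<ge> k * C" for n
    using ge[of n] div_le_mono[OF that, of k] k by simp
  show ?thesis
  proof (rule convergent_of_div_superadditive[of "k * C"])
    fix n assume n: "n \<ge> k * C"
    obtain H :: "nat hypergraph" where H: "kgraph k H" "card (verts H) = n" "free_of \<F> H"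
      "ex_pos k n \<F> = min_pos_codegree k H"
      using ex_pos_attained[OF ne] by metis
    have C: "C \<le> min_pos_codegree k H" using large[OF n] H by simp
    then have neH: "edges H \<noteq> {}" by (auto simp: min_pos_codegree_def C_def split: if_splits)
    have ge: "pos_codegree_ge k H (min_pos_codegree k H)"
      using H k by (intro pos_codegree_ge_min) auto
    show "ex_pos k n \<F> \<le> n" using pos_codegree_ge_le_card[OF H(1) neH ge] H by simp
    fix N
    have "N div card (verts H) * min_pos_codegree k H \<le> ex_pos k N \<F>"
    proof (rule ex_pos_ge_blowup[OF H(1) _ neH ge])
      fix F f assume F: "F \<in> \<F>"
      then obtain c where c: "c > k" "cored k c F" using cored by blast
      have "card (verts F) \<le> C" unfolding C_def
        using F fin by (intro trans_le_add1 member_le_sum) auto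
      then have "pos_codegree_ge k H (card (verts F))"
        using ge C unfolding pos_codegree_ge_def by (meson order_trans)
      then show "\<not> hom F H f"
        using H(3) F cored_hom_imp_has_copy[OF c(2) _ _ H(1)] c k unfolding free_of_def
        by (metis less_imp_le order_trans one_le_numeral)
    qed (use k in simp)
    then show "N div n * ex_pos k n \<F> \<le> ex_pos k N \<F>" using H by simp
  qed
qed

text \<open>Balanced blow-ups of one fixed \<open>H\<close> have positive codegree ratio tending to
  \<open>d / card (verts H)\<close>.\<close>

lemma pos_codegree_density_ge:
  fixes H :: "nat hypergraph"
  assumes k: "k \<ge> 2" and fin: "finite \<F>"
    and cored: "\<And>F. F \<in> \<F> \<Longrightarrow> \<exists>c>k. cored k c F"
    and H: "kgraph k H" and ne: "edges H \<noteq> {}"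
    and d: "pos_codegree_ge k H d" and free: "\<And>F f. F \<in> \<F> \<Longrightarrow> \<not> hom F H f"
  shows "real d / real (card (verts H)) \<le> pos_codegree_density k \<F>"
proof -
  have "verts H \<noteq> {}" "finite (verts H)" using H ne k unfolding kgraph_def
    by fastforce+
  then have "card (verts H) > 0" by (simp add: card_gt_0_iff)
  note lim = div_mult_tendsto[OF this, of d]
  have "(\<lambda>n. real (ex_pos k n \<F>) / real n) \<longlonglongrightarrow> pos_codegree_density k \<F>"
    unfolding pos_codegree_density_def
    using convergent_ex_pos_cored[OF k fin cored] by (simp add: convergent_LIMSEQ_iff)
  moreover have "real (N div card (verts H) * d) / real N \<le> real (ex_pos k N \<F>) / real N" for N
    using ex_pos_ge_blowup[OF H _ ne d free, of \<F> N] k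
    by (intro divide_right_mono) (auto simp del: of_nat_mult)
  ultimately show ?thesis by (intro LIMSEQ_le[OF lim]) auto
qed

lemma pos_codegree_density_le:
  assumes k: "k \<ge> 2" and fin: "finite \<F>"
    and cored: "\<And>F. F \<in> \<F> \<Longrightarrow> \<exists>c>k. cored k c F"
    and le: "\<And>n. n \<ge> n0 \<Longrightarrow> real (ex_pos k n \<F>) \<le> r * real n"
  shows "pos_codegree_density k \<F> \<le> r"
proof -
  have "(\<lambda>n. real (ex_pos k n \<F>) / real n) \<longlonglongrightarrow> pos_codegree_density k \<F>"
    unfolding pos_codegree_density_def
    using convergent_ex_pos_cored[OF k fin cored] by (simp add: convergent_LIMSEQ_iff)
  then show ?thesis
    by (rule LIMSEQ_le_const2)
      (use le in \<open>auto simp: divide_le_eq intro!: exI[of _ "Suc n0"]\<close>)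
qed

subsection \<open>The two forbidden hypergraphs\<close>

lemma cored_clique:
  assumes k: "k \<ge> 2"
  shows "cored k (k + 1) (clique k (k + 1))"
proof -
  have "covered (clique k (k + 1)) i j" if ij: "i < k + 1" "j < k + 1" "i \<noteq> j" for i j
  proof -
    have "card {i, j} \<le> k" using k ij by simp
    then obtain e where "{i, j} \<subseteq> e" "e \<subseteq> {..<k + 1}" "card e = k"
      using ij exists_subset_between[of "{i, j}" k "{..<k + 1}"] by auto
    then show ?thesis by (auto simp: covered_def clique_def)
  qed
  then show ?thesis
    by (auto simp: cored_def kgraph_clique) (auto simp: clique_def)
qed

text \<open>This is the expansion of the complete graph on \<open>c\<close> vertices:
  \<open>h\<close> enumerates the core pairs, and the \<open>p\<close>-th pair is completed by its
  own block of \<open>k - 2\<close> new vertices.\<close>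

lemma exists_clique_expansion:
  assumes k: "k \<ge> 3"
  shows "\<exists>F. cored k c F \<and> (\<forall>e\<in>edges F. \<exists>i<c. \<exists>j<c. i \<noteq> j \<and> e \<inter> {..<c} = {i, j})"
proof -
  define P where "P = {p. p \<subseteq> {..<c} \<and> card p = 2}"
  define M where "M = card P"
  have "finite P" unfolding P_def by simp
  then obtain h where h: "bij_betw h {0..<M} P"
    unfolding M_def using ex_bij_betw_nat_finite by blast
  have hP: "h p \<subseteq> {..<c}" "card (h p) = 2" "finite (h p)" if "p < M" for p
  proof -
    have "h p \<in> P" using bij_betw_apply[OF h] that by simp
    then show "h p \<subseteq> {..<c}" "card (h p) = 2" "finite (h p)"
      unfolding P_def by (auto intro: finite_subset)
  qed
  \<comment> \<open>Blocks are consecutive intervals after the core, so division by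
    \<open>k - 2\<close>, positive as \<open>k \<ge> 3\<close>, recovers the block of a
    vertex.\<close>
  define block where "block p = {v. c \<le> v \<and> (v - c) div (k - 2) = p}" for p
  have block: "block p = {c + p * (k - 2)..<c + (p + 1) * (k - 2)}" for p
  proof (rule set_eqI)
    fix v
    show "v \<in> block p \<longleftrightarrow> v \<in> {c + p * (k - 2)..<c + (p + 1) * (k - 2)}"
    proof (cases "c \<le> v")
      case True
      then obtain w where "v = c + w" by (auto simp: le_iff_add)
      moreover have "w div (k - 2) = p \<longleftrightarrow> p * (k - 2) \<le> w \<and> w < Suc p * (k - 2)"
      proof
        assume "w div (k - 2) = p"
        then show "p * (k - 2) \<le> w \<and> w < Suc p * (k - 2)"
          using div_times_less_eq_dividend[of w "k - 2"] dividend_less_div_times[of "k - 2" w] k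
          by simp
      qed (auto intro!: div_nat_eqI simp: mult.commute)
      ultimately show ?thesis by (auto simp: block_def)
    qed (auto simp: block_def)
  qed
  define N where "N = c + M * (k - 2)"
  define F where "F = Hypergraph {..<N} ((\<lambda>p. h p \<union> block p) ` {..<M})"
  have core: "(h p \<union> block p) \<inter> {..<c} = h p" if "p < M" for p
    using hP(1)[OF that] by (auto simp: block_def)
  have kF: "kgraph k F"
  proof -
    have "h p \<union> block p \<subseteq> {..<N} \<and> card (h p \<union> block p) = k" if p: "p < M" for p
    proof
      have "(p + 1) * (k - 2) \<le> M * (k - 2)" using p by (intro mult_right_mono) auto
      then have "block p \<subseteq> {..<N}" unfolding block N_def by auto
      moreover have "h p \<subseteq> {..<N}" using hP[OF p] unfolding N_def by auto
      ultimately show "h p \<union> block p \<subseteq> {..<N}" by simp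
      have "h p \<inter> block p = {}" using hP[OF p] by (auto simp: block_def)
      moreover have "finite (block p)" "card (block p) = k - 2" unfolding block by auto
      ultimately show "card (h p \<union> block p) = k"
        using k hP[OF p] by (simp add: card_Un_disjoint)
    qed
    then show ?thesis by (auto simp: kgraph_def F_def)
  qed
  have uniq: "\<exists>!e. e \<in> edges F \<and> v \<in> e" if v: "v \<in> {c..<N}" for v
  proof
    let ?p = "(v - c) div (k - 2)"
    have "?p < M" using v k unfolding N_def by (simp add: div_less_iff_less_mult less_diff_conv2 add.commute)
    then show "h ?p \<union> block ?p \<in> edges F \<and> v \<in> h ?p \<union> block ?p"
      using v by (auto simp: F_def block_def)
    fix e assume "e \<in> edges F \<and> v \<in> e"
    then obtain q where q: "q < M" "e = h q \<union> block q" "v \<in> h q \<union> block q" by (auto simp: F_def)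
    then have "v \<in> block q" using v hP(1)[of q] by auto
    then show "e = h ?p \<union> block ?p" using q by (simp add: block_def)
  qed
  have cov: "covered F i j" if ij: "i < c" "j < c" "i \<noteq> j" for i j
  proof -
    have "{i, j} \<in> P" using ij by (auto simp: P_def)
    then obtain p where "p < M" "h p = {i, j}"
      using h by (metis atLeastLessThan_iff bij_betw_imp_surj_on imageE)
    then show ?thesis by (auto simp: covered_def F_def intro!: bexI[of _ p])
  qed
  have "\<exists>i<c. \<exists>j<c. i \<noteq> j \<and> e \<inter> {..<c} = {i, j}" if "e \<in> edges F" for e
  proof -
    have "e \<in> (\<lambda>p. h p \<union> block p) ` {..<M}" using that by (simp add: F_def)
    then obtain p where p: "e = h p \<union> block p" "p \<in> {..<M}" by (rule imageE)
    then have pM: "p < M" by simp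
    obtain i j where "h p = {i, j}" "i \<noteq> j"
      using hP(2)[OF pM] by (auto simp: card_2_iff)
    then show ?thesis using core[OF pM] hP(1)[OF pM] p(1) by auto
  qed
  moreover have "c \<le> N" "verts F = {..<N}" by (auto simp: N_def F_def)
  then have "cored k c F"
    unfolding cored_def using kF uniq cov by (intro conjI exI[of _ N] ballI allI impI)
  ultimately show ?thesis by (intro exI[of _ F] conjI ballI)
qed

text \<open>The second part has k - 2 more vertices than the first because a (k - 1)-set that meets the first
  part already uses k - 2 vertices of the second; so both kinds of (k - 1)-sets have codegree s.\<close>

definition split_graph :: "nat \<Rightarrow> nat \<Rightarrow> nat hypergraph" where
  "split_graph k s = Hypergraph {..<s + (s + k - 2)}
     {e. e \<subseteq> {..<s + (s + k - 2)} \<and> card e = k \<and> card (e \<inter> {..<s}) = 1}"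

lemma kgraph_split_graph: "kgraph k (split_graph k s)"
  by (auto simp: kgraph_def split_graph_def)

lemma edges_split_graph_nonempty:
  assumes "k \<ge> 2" "s \<ge> 1"
  shows "edges (split_graph k s) \<noteq> {}"
proof -
  \<comment> \<open>An interval of length \<open>k\<close> starting at the last vertex of the first
    part.\<close>
  define I where "I = {s - 1..<s + k - 1}"
  have "I \<inter> {..<s} = {s - 1}" using assms by (auto simp: I_def)
  moreover have "I \<subseteq> {..<s + (s + k - 2)}" using assms by (auto simp: I_def)
  moreover have "card I = k" using assms by (simp add: I_def)
  ultimately have "I \<in> edges (split_graph k s)" by (simp add: split_graph_def)
  then show ?thesis by blast
qed

lemma pos_codegree_ge_split_graph:
  assumes k: "k \<ge> 2"
  shows "pos_codegree_ge k (split_graph k s) s"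
  unfolding pos_codegree_ge_def
proof (intro allI impI)
  let ?G = "split_graph k s" and ?V = "{..<s + (s + k - 2)}"
  fix S e assume S: "card S = k - 1" and e: "e \<in> edges ?G" and Se: "S \<subseteq> e"
  have e': "e \<subseteq> ?V" "card (e \<inter> {..<s}) = 1" using e by (auto simp: split_graph_def)
  have SV: "S \<subseteq> ?V" using Se e' by simp
  then have fin: "finite S" by (rule finite_subset) simp
  obtain x where x: "e \<inter> {..<s} = {x}" using e'(2) by (auto simp: card_1_singleton_iff)
  have Sx: "S \<inter> {..<s} \<subseteq> {x}"
    unfolding x[symmetric] using Se by (rule Int_mono) simp
  have xs: "x < s" using x by (metis Int_iff insertI1 lessThan_iff)
  have "\<exists>E. E \<subseteq> extensions ?G S \<and> s \<le> card E"
  proof (cases "x \<in> S")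
    case False
    then have disj: "S \<inter> {..<s} = {}" using Sx by (metis Int_iff subset_singletonD insertI1)
    have "{..<s} \<subseteq> extensions ?G S"
    proof
      fix y assume y: "y \<in> {..<s}"
      then have "insert y S \<inter> {..<s} = {y}" "y \<notin> S" using disj by auto
      then show "y \<in> extensions ?G S"
        using y SV S fin k by (auto simp: extensions_def split_graph_def)
    qed
    then show ?thesis by (intro exI[of _ "{..<s}"]) simp
  next
    case True
    then have Sx': "S \<inter> {..<s} = {x}" using Sx xs by auto
    \<comment> \<open>\<open>S\<close> occupies \<open>k - 2\<close> of the \<open>s + k - 2\<close>
      vertices of the second part, leaving \<open>s\<close> extensions.\<close>
    let ?E = "{s..<s + (s + k - 2)} - (S - {x})"
    have "?E \<subseteq> extensions ?G S"
    proof
      fix y assume y: "y \<in> ?E"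
      have "insert y S \<inter> {..<s} = S \<inter> {..<s}" using y by auto
      moreover have "y \<notin> S" using y xs by auto
      ultimately have "insert y S \<inter> {..<s} = {x}" "y \<notin> S" unfolding Sx' .
      then show "y \<in> extensions ?G S"
        using y SV S fin k by (auto simp: extensions_def split_graph_def)
    qed
    moreover have "card (S - {x}) = k - 2" using S fin True k by simp
    then have "s \<le> card ?E"
      using diff_card_le_card_Diff[of "S - {x}" "{s..<s + (s + k - 2)}"] fin k by simp
    ultimately show ?thesis by blast
  qed
  then show "s \<le> card (extensions ?G S)"
    using card_mono extensions_subset(2)[OF kgraph_split_graph] by (meson order_trans)
qed

text \<open>Each \<open>k\<close> of the \<open>k + 1\<close> image vertices must include exactly
  one from the first part. Omitting that one shows that there is a second, but then omitting a third
  vertex leaves two.\<close>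

lemma split_graph_no_clique:
  assumes k: "k \<ge> 2"
  shows "\<not> hom (clique k (k + 1)) (split_graph k s) f"
proof
  assume f: "hom (clique k (k + 1)) (split_graph k s) f"
  have inj: "inj_on f {..<k + 1}"
    by (rule cored_hom_inj[OF cored_clique[OF k] kgraph_split_graph f])
  have one: "card (f ` ({..<k + 1} - {i}) \<inter> {..<s}) = 1" if "i < k + 1" for i
  proof -
    have "{..<k + 1} - {i} \<in> edges (clique k (k + 1))" using that by (auto simp: clique_def)
    then show ?thesis using f by (auto simp: hom_def split_graph_def)
  qed
  have two: False if ij: "i < k + 1" "j < k + 1" "i \<noteq> j" "f i < s" "f j < s" for i j
  proof -
    have "\<not> {..<k + 1} \<subseteq> {i, j}"
    proof
      assume "{..<k + 1} \<subseteq> {i, j}"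
      then have "card {..<k + 1} \<le> card {i, j}" by (intro card_mono) auto
      then show False using k ij by simp
    qed
    then obtain l where l: "l < k + 1" "l \<noteq> i" "l \<noteq> j" by auto
    have "f i \<noteq> f j" using inj ij by (auto simp: inj_on_def)
    then have "2 = card {f i, f j}" by simp
    also have "\<dots> \<le> card (f ` ({..<k + 1} - {l}) \<inter> {..<s})"
      using ij l by (intro card_mono) auto
    finally show False using one[OF l(1)] by simp
  qed
  have ex: "\<exists>j<k + 1. j \<noteq> i \<and> f j < s" if "i < k + 1" for i
  proof -
    have "f ` ({..<k + 1} - {i}) \<inter> {..<s} \<noteq> {}" using one[OF that] by force
    then show ?thesis by auto
  qed
  obtain i where i: "i < k + 1" "f i < s" using ex[of 0] by auto
  then obtain j where "j < k + 1" "j \<noteq> i" "f j < s" using ex by blast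
  then show False using two i by blast
qed

subsection \<open>The upper bound for the pair\<close>

text \<open>Among all (k+1)-sets of vertices take one, Y, spanning the maximal number m of edges, and let M
  be the set of vertices of Y whose removal leaves an edge. If m is at least 3, all pairs of Y are
  covered, so each vertex x misses some y in Y: either x = y, or x and y are not covered. Then x
  extends Y - {p, q} only if y is p or q, and by maximality (applied to Y - y + x) this happens for
  at most 2m - 2 ordered pairs with p in M. If m is at most 2, the (k-1)-subsets of an edge have
  pairwise disjoint extensions.\<close>

lemma pos_codegree_upper_bound:
  assumes H: "kgraph k H" and k: "k \<ge> 2" and ne: "edges H \<noteq> {}"
    and d: "pos_codegree_ge k H d"
    and no_clique: "\<And>Y. Y \<subseteq> verts H \<Longrightarrow> card Y = k + 1 \<Longrightarrow> \<exists>y\<in>Y. Y - {y} \<notin> edges H"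
    and no_covered: "\<And>Z. Z \<subseteq> verts H \<Longrightarrow> card Z = k + 2 \<Longrightarrow>
        \<exists>x\<in>Z. \<exists>y\<in>Z. x \<noteq> y \<and> \<not> covered H x y"
  shows "k * k * d \<le> 2 * (k - 1) * card (verts H)"
proof -
  let ?V = "verts H" and ?n = "card (verts H)"
  define M where "M Y = {y \<in> Y. Y - {y} \<in> edges H}" for Y
  have finV: "finite ?V" using H by (simp add: kgraph_def)
  show ?thesis
  proof (cases "\<exists>Y\<subseteq>?V. card Y = k + 1 \<and> card (M Y) \<ge> 3")
    case False
    obtain e where e: "e \<in> edges H" using ne by blast
    have e': "e \<subseteq> ?V" "card e = k" "finite e" using kgraphD[OF H e] by auto
    have "k * d = (\<Sum>u\<in>e. d)" using e' by simp
    also have "\<dots> \<le> (\<Sum>u\<in>e. card (extensions H (e - {u})))"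
    proof (rule sum_mono)
      fix u assume "u \<in> e"
      then have "card (e - {u}) = k - 1" using e' by simp
      then show "d \<le> card (extensions H (e - {u}))"
        using d e unfolding pos_codegree_ge_def by (meson Diff_subset)
    qed
    also have "\<dots> = card (\<Union>u\<in>e. extensions H (e - {u}))"
    proof (rule card_UN_disjoint[symmetric])
      show "\<forall>u\<in>e. \<forall>v\<in>e. u \<noteq> v \<longrightarrow> extensions H (e - {u}) \<inter> extensions H (e - {v}) = {}"
      proof (intro ballI impI, rule ccontr)
        \<comment> \<open>A common extension \<open>x\<close> would make \<open>insert x e\<close>
          lose an edge-completing vertex in three ways: removing \<open>x\<close>, \<open>u\<close>
          or \<open>v\<close> leaves an edge.\<close>
        fix u v assume uv: "u \<in> e" "v \<in> e" "u \<noteq> v"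
          "extensions H (e - {u}) \<inter> extensions H (e - {v}) \<noteq> {}"
        then obtain x where x: "x \<in> extensions H (e - {u})" "x \<in> extensions H (e - {v})" by blast
        then have xe: "x \<notin> e" using uv by (auto simp: extensions_def)
        have "x \<in> ?V" using x extensions_subset[OF H] by blast
        then have "insert x e \<subseteq> ?V" "card (insert x e) = k + 1" using e' xe by auto
        moreover have "{x, u, v} \<subseteq> M (insert x e)"
          using x xe uv e by (auto simp: M_def extensions_def insert_Diff_if)
        then have "card {x, u, v} \<le> card (M (insert x e))"
          using e' by (intro card_mono) (auto simp: M_def)
        moreover have "x \<noteq> u" "x \<noteq> v" using xe uv(1,2) by blast+
        then have "card {x, u, v} = 3" using uv(3) by simp
        ultimately show False using False by metis
      qed
    qed (use e' extensions_subset[OF H] in auto)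
    also have "\<dots> \<le> ?n"
      using extensions_subset[OF H] finV by (intro card_mono) auto
    finally have "k * (k * d) \<le> k * ?n" by simp
    also have "\<dots> \<le> 2 * (k - 1) * ?n" using k by (intro mult_right_mono) auto
    finally show ?thesis by (simp add: mult.assoc)
  next
    case True
    define \<Y> where "\<Y> = {Y. Y \<subseteq> ?V \<and> card Y = k + 1}"
    have fin\<Y>: "finite \<Y>" using finV unfolding \<Y>_def by simp
    moreover have "\<Y> \<noteq> {}" using True unfolding \<Y>_def by blast
    ultimately have "Max ((\<lambda>Y. card (M Y)) ` \<Y>) \<in> (\<lambda>Y. card (M Y)) ` \<Y>"
      by (intro Max_in) auto
    then obtain Y where Y: "Y \<in> \<Y>" and maxY': "card (M Y) = Max ((\<lambda>Y. card (M Y)) ` \<Y>)" by auto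
    have maxY: "card (M Y') \<le> card (M Y)" if "Y' \<in> \<Y>" for Y'
      unfolding maxY' using that fin\<Y> by (intro Max_ge) auto
    define m where "m = card (M Y)"
    have m3: "m \<ge> 3" using True maxY unfolding m_def \<Y>_def
      by (metis (mono_tags, lifting) mem_Collect_eq order_trans)
    have Y': "Y \<subseteq> ?V" "card Y = k + 1" using Y by (auto simp: \<Y>_def)
    have finY: "finite Y" using Y'(1) finV by (rule finite_subset)
    have MY: "M Y \<subseteq> Y" "finite (M Y)" using finY by (auto simp: M_def)
    \<comment> \<open>Since \<open>Y\<close> does not span a complete hypergraph, some vertex lies
      outside \<open>M Y\<close>.\<close>
    have mk: "m \<le> k"
    proof -
      obtain y where "y \<in> Y" "Y - {y} \<notin> edges H" using no_clique[OF Y'] by blast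
      then have "M Y \<subset> Y" by (auto simp: M_def)
      then have "card (M Y) < card Y" using finY by (rule psubset_card_mono[rotated])
      then show ?thesis using Y' unfolding m_def by simp
    qed
    \<comment> \<open>With three choices in \<open>M Y\<close>, one can be removed that is neither
      \<open>u\<close> nor \<open>w\<close>; the remaining edge contains both.\<close>
    have cov: "covered H u w" if uw: "u \<in> Y" "w \<in> Y" for u w
    proof -
      have "\<not> M Y \<subseteq> {u, w}"
      proof
        assume "M Y \<subseteq> {u, w}"
        then have "card (M Y) \<le> card {u, w}" by (intro card_mono) auto
        also have "\<dots> \<le> 2" by (simp add: card_insert_if)
        finally show False using m3 unfolding m_def by simp
      qed
      then obtain p where "p \<in> M Y" "p \<noteq> u" "p \<noteq> w" by blast
      then have "Y - {p} \<in> edges H" "u \<in> Y - {p}" "w \<in> Y - {p}" using uw by (auto simp: M_def)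
      then show ?thesis unfolding covered_def by (intro bexI[of _ "Y - {p}"] conjI)
    qed
    \<comment> \<open>Adding \<open>x\<close> to \<open>Y\<close> gives \<open>k + 2\<close>
      vertices, and by \<open>cov\<close> any uncovered pair among them involves
      \<open>x\<close>.\<close>
    have missed: "\<exists>y\<in>Y. x = y \<or> x \<notin> Y \<and> \<not> covered H x y" if x: "x \<in> ?V" for x
    proof (cases "x \<in> Y")
      case False
      then have "insert x Y \<subseteq> ?V" "card (insert x Y) = k + 2" using x Y' finY by auto
      then obtain u w where uw: "u \<in> insert x Y" "w \<in> insert x Y" "u \<noteq> w" "\<not> covered H u w"
        using no_covered by metis
      moreover have "\<not> covered H w u" using uw(4) by (auto simp: covered_def)
      ultimately show ?thesis using cov False by blast
    qed blast
    \<comment> \<open>Double counting of pairs in \<open>R\<close> against vertices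
      \<open>x\<close>: removing \<open>p\<close> leaves an edge, so removing \<open>q\<close> as
      well leaves a set of positive codegree.\<close>
    define R where "R = (SIGMA p:M Y. Y - {p})"
    have cardR: "card R = m * k"
    proof -
      have "card R = (\<Sum>p\<in>M Y. card (Y - {p}))" unfolding R_def using MY finY by (subst card_SigmaI) auto
      also have "\<dots> = (\<Sum>p\<in>M Y. k)" using MY Y' by (intro sum.cong) auto
      finally show ?thesis by (simp add: m_def)
    qed
    have finR: "finite R" unfolding R_def using MY finY by auto
    have extR: "d \<le> card (extensions H (Y - {p, q}))" if "(p, q) \<in> R" for p q
    proof -
      have pq: "p \<in> M Y" "p \<in> Y" "q \<in> Y" "p \<noteq> q" using that MY by (auto simp: R_def)
      have "card (Y - {p, q}) = k - 1" using pq Y' finY by (simp add: card_Diff_subset)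
      moreover have "Y - {p} \<in> edges H" using pq by (simp add: M_def)
      moreover have "Y - {p, q} \<subseteq> Y - {p}" by blast
      ultimately show ?thesis using d unfolding pos_codegree_ge_def by blast
    qed
    define A where "A x = {r \<in> R. x \<in> extensions H (Y - {fst r, snd r})}" for x
    have cardA: "card (A x) \<le> 2 * (m - 1)" if x: "x \<in> ?V" for x
    proof -
      obtain y where y: "y \<in> Y" "x = y \<or> x \<notin> Y \<and> \<not> covered H x y" using missed[OF x] by blast
      define Q where "Q = {q \<in> Y - {y}. x \<in> extensions H (Y - {y, q})}"
      \<comment> \<open>The exchange of \<open>y\<close> for \<open>x\<close>, to which maximality
        of \<open>Y\<close> applies; it is \<open>Y\<close> itself when
        \<open>x = y\<close>.\<close>
      define Y2 where "Y2 = insert x (Y - {y})"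
      have x_new: "x \<notin> Y - {y}" using y by blast
      have "Y2 \<subseteq> ?V" "card Y2 = k + 1" unfolding Y2_def using x x_new y Y' finY by auto
      then have cardY2: "card (M Y2) \<le> m" unfolding m_def by (intro maxY) (simp add: \<Y>_def)
      have finM2: "finite (M Y2)" unfolding M_def Y2_def using finY by simp
      have QM: "Q \<subseteq> M Y2"
      proof
        fix q assume q: "q \<in> Q"
        then have "q \<noteq> x" using x_new by (auto simp: Q_def)
        then have "Y2 - {q} = insert x (Y - {y, q})" unfolding Y2_def by blast
        then show "q \<in> M Y2" using q by (auto simp: Q_def M_def Y2_def extensions_def)
      qed
      have finQ: "finite Q" using QM finM2 by (rule finite_subset)
      have sub: "A x \<subseteq> (if y \<in> M Y then {y} \<times> Q else {}) \<union> Q \<times> {y}"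
      proof
        fix r assume r: "r \<in> A x"
        obtain p q where pq: "r = (p, q)" by fastforce
        have R: "p \<in> M Y" "p \<in> Y" "q \<in> Y" "q \<noteq> p" "x \<in> extensions H (Y - {p, q})"
          using r MY pq by (auto simp: A_def R_def)
        have "y = p \<or> y = q"
        proof (rule ccontr)
          assume "\<not> (y = p \<or> y = q)"
          then have y': "y \<in> Y - {p, q}" using y by blast
          then have "x \<noteq> y" using R(5) by (auto simp: extensions_def)
          moreover have "covered H x y"
            unfolding covered_def using y' R(5)
            by (intro bexI[of _ "insert x (Y - {p, q})"]) (auto simp: extensions_def)
          ultimately show False using y by blast
        qed
        then show "r \<in> (if y \<in> M Y then {y} \<times> Q else {}) \<union> Q \<times> {y}"
          using R unfolding pq by (auto simp: Q_def insert_commute)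
      qed
      show ?thesis
      \<comment> \<open>If \<open>y\<close> is in \<open>M Y\<close>, both orders of a pair may
        count, but \<open>x\<close> takes one place in \<open>M Y2\<close> outside \<open>Q\<close>.
        Otherwise only one order counts, and \<open>m \<le> 2 * (m - 1)\<close>.\<close>
      proof (cases "y \<in> M Y")
        case True
        have "Y2 - {x} = Y - {y}" unfolding Y2_def using x_new by blast
        then have "x \<in> M Y2" using True unfolding M_def by (simp add: Y2_def)
        moreover have "x \<notin> Q" using x_new by (auto simp: Q_def)
        ultimately have "Q \<subset> M Y2" using QM by blast
        then have "card Q < m"
          using psubset_card_mono[OF finM2] cardY2 by (meson less_le_trans)
        moreover have "card (A x) \<le> card ({y} \<times> Q \<union> Q \<times> {y})"
          using sub True finQ by (intro card_mono) auto
        moreover have "\<dots> \<le> card ({y} \<times> Q) + card (Q \<times> {y})" by (rule card_Un_le)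
        ultimately show ?thesis by (simp add: card_cartesian_product)
      next
        case False
        have "card (A x) \<le> card (Q \<times> {y})" using sub False finQ by (intro card_mono) auto
        also have "\<dots> \<le> m"
          using card_mono[OF finM2 QM] cardY2 by (simp add: card_cartesian_product)
        finally show ?thesis using m3 by simp
      qed
    qed
    have "m * k * d = (\<Sum>r\<in>R. d)" using cardR by simp
    also have "\<dots> \<le> (\<Sum>r\<in>R. card {x \<in> ?V. x \<in> extensions H (Y - {fst r, snd r})})"
    proof (rule sum_mono)
      fix r assume r: "r \<in> R"
      have "{x \<in> ?V. x \<in> extensions H (Y - {fst r, snd r})} = extensions H (Y - {fst r, snd r})"
        using extensions_subset(1)[OF H] by blast
      then show "d \<le> card {x \<in> ?V. x \<in> extensions H (Y - {fst r, snd r})}"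
        using extR[of "fst r" "snd r"] r by simp
    qed
    also have "\<dots> = (\<Sum>x\<in>?V. card (A x))"
      by (rule sum_multicount_gen[OF finR finV]) (simp add: A_def)
    also have "\<dots> \<le> (\<Sum>x\<in>?V. 2 * (m - 1))" by (intro sum_mono cardA)
    also have "\<dots> = 2 * (m - 1) * ?n" by simp
    finally have "k * (m * k * d) \<le> k * (2 * (m - 1) * ?n)" by simp
    also have "\<dots> = 2 * (k * (m - 1)) * ?n" by simp
    \<comment> \<open>Here \<open>m \<le> k\<close> enters: the ratio \<open>(m - 1) / m\<close> is
      largest at \<open>m = k\<close>.\<close>
    also have "k * (m - 1) \<le> m * (k - 1)" using mk by (simp add: diff_mult_distrib2 mult.commute)
    finally have "m * (k * k * d) \<le> m * (2 * (k - 1) * ?n)" by (simp add: ac_simps)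
    then show ?thesis using m3 by simp
  qed
qed

section \<open>Comparison of the three densities\<close>

theorem theorem1:
  fixes k :: nat
  assumes "k \<ge> 3"
  shows "\<exists>F1 F2 :: nat hypergraph. kgraph k F1 \<and> kgraph k F2
    \<and> 0 < pos_codegree_density k {F1, F2}
    \<and> pos_codegree_density k {F1, F2}
        < min (pos_codegree_density k {F1}) (pos_codegree_density k {F2})"
proof -
  have k2: "k \<ge> 2" and k1: "k \<ge> 1" using assms by auto
  obtain F2 where F2: "cored k (k + 2) F2"
    and F2_core: "\<And>e. e \<in> edges F2 \<Longrightarrow> \<exists>i<k + 2. \<exists>j<k + 2. i \<noteq> j \<and> e \<inter> {..<k + 2} = {i, j}"
    using exists_clique_expansion[OF assms, of "k + 2"] by blast
  define F1 where "F1 = clique k (k + 1)"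
  have F1: "cored k (k + 1) F1" unfolding F1_def using k2 by (rule cored_clique)
  have cored: "\<exists>c>k. cored k c F" if "F \<in> {F1, F2}" for F
    using that F1 F2 by (metis add_2_eq_Suc' insertE lessI less_SucI singletonD Suc_eq_plus1)
  have no_hom_F: "\<not> hom F (clique k k) f" if "F \<in> {F1, F2}" for F f
  proof -
    obtain c where "c > k" "cored k c F" using cored \<open>F \<in> _\<close> by blast
    then show ?thesis
      using k2 by (intro cored_no_hom_small[OF _ _ kgraph_clique]) (auto simp: clique_def)
  qed

  have lower: "1 / real k \<le> pos_codegree_density k {F1, F2}"
  proof -
    have "real (k - k + 1) / real (card (verts (clique k k))) \<le> pos_codegree_density k {F1, F2}"
      using cored no_hom_F
      by (intro pos_codegree_density_ge[OF k2 _ _ kgraph_clique edges_clique_nonempty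
            pos_codegree_ge_clique[OF k1]]) auto
    then show ?thesis by (simp add: clique_def)
  qed

  \<comment> \<open>5 is the least s for which s/(2s + k - 2) exceeds 2(k - 1)/k^2 for all k at least 3.\<close>
  have lower1: "5 / real (k + 8) \<le> pos_codegree_density k {F1}"
  proof -
    have "real 5 / real (card (verts (split_graph k 5))) \<le> pos_codegree_density k {F1}"
      using cored split_graph_no_clique[OF k2] k2
      by (intro pos_codegree_density_ge[OF k2 _ _ kgraph_split_graph edges_split_graph_nonempty
            pos_codegree_ge_split_graph]) (auto simp: F1_def)
    moreover have "card (verts (split_graph k 5)) = k + 8" using k2 by (simp add: split_graph_def)
    ultimately show ?thesis by simp
  qed

  have lower2: "2 / real (k + 1) \<le> pos_codegree_density k {F2}"
  proof -
    \<comment> \<open>The core of \<open>F2\<close> has one vertex more than the target.\<close>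
    have "\<not> hom F2 (clique k (k + 1)) f" for f
      using F2 by (rule cored_no_hom_small[OF _ _ kgraph_clique]) (auto simp: clique_def)
    then have "real (k + 1 - k + 1) / real (card (verts (clique k (k + 1))))
        \<le> pos_codegree_density k {F2}"
      using cored k1
      by (intro pos_codegree_density_ge[OF k2 _ _ kgraph_clique edges_clique_nonempty
            pos_codegree_ge_clique]) auto
    then show ?thesis by (simp add: clique_def)
  qed

  define C where "C = card (verts F2) + 1"
  have upper: "pos_codegree_density k {F1, F2} \<le> 2 * (real k - 1) / (real k * real k)"
  proof (rule pos_codegree_density_le[OF k2 _ cored])
    fix n :: nat assume "n \<ge> C * (k * k)"
    then have nC: "C * (k * k) \<le> n" .
    obtain H :: "nat hypergraph" where H: "kgraph k H" "card (verts H) = n" "free_of {F1, F2} H"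
      and ex: "ex_pos k n {F1, F2} = min_pos_codegree k H"
      using ex_pos_attained[of "{F1, F2}" k n] cored_edges_nonempty[OF F1] cored_edges_nonempty[OF F2] k1
      by auto
    let ?d = "min_pos_codegree k H"
    have d: "pos_codegree_ge k H ?d" using H(1) k1 by (rule pos_codegree_ge_min)
    have "k * k * ?d \<le> 2 * (k - 1) * n"
    \<comment> \<open>Below \<open>C\<close> the bound is trivial for the large \<open>n\<close>
      considered; from \<open>C\<close> on, private vertices of \<open>F2\<close> can be placed
      greedily.\<close>
    proof (cases "C \<le> ?d")
      case False
      then have "k * k * ?d \<le> k * k * C" by (intro mult_left_mono) auto
      also have "\<dots> \<le> 1 * n" using nC by (simp add: ac_simps)
      also have "\<dots> \<le> 2 * (k - 1) * n" using k2 by (intro mult_right_mono) auto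
      finally show ?thesis .
    next
      case True
      then have ne: "edges H \<noteq> {}" by (auto simp: min_pos_codegree_def C_def split: if_splits)
      show ?thesis
        unfolding H(2)[symmetric]
      proof (rule pos_codegree_upper_bound[OF H(1) k2 ne d])
        fix Y assume Y: "Y \<subseteq> verts H" "card Y = k + 1"
        have "finite Y" using Y(2) by (intro card_ge_0_finite) simp
        then obtain g where g: "bij_betw g {..<k + 1} Y"
          using Y ex_bij_betw_nat_finite[of Y] by (auto simp: lessThan_atLeast0)
        show "\<exists>y\<in>Y. Y - {y} \<notin> edges H"
        proof (rule ccontr)
          assume all: "\<not> ?thesis"
          have "g ` e \<in> edges H" if e: "e \<in> edges F1" for e
          proof -
            have e': "e \<subseteq> {..<k + 1}" "card e = k" using e by (auto simp: F1_def clique_def)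
            then have "g ` e \<subseteq> Y" "card (g ` e) = k"
              using g by (auto simp: bij_betw_def card_image inj_on_subset)
            then have "card (Y - g ` e) = 1" using Y \<open>finite Y\<close>
              by (simp add: card_Diff_subset finite_subset)
            then obtain y where "Y - g ` e = {y}" by (auto simp: card_1_singleton_iff)
            then have "g ` e = Y - {y}" "y \<in> Y" using \<open>g ` e \<subseteq> Y\<close> by auto
            then show ?thesis using all by simp
          qed
          then have "has_copy H F1"
            using g Y unfolding has_copy_def
            by (intro exI[of _ g]) (auto simp: F1_def clique_def bij_betw_def)
          then show False using H(3) by (simp add: free_of_def)
        qed
      next
        fix Z assume Z: "Z \<subseteq> verts H" "card Z = k + 2"
        have "finite Z" using Z(2) by (intro card_ge_0_finite) simp
        then obtain g where g: "bij_betw g {..<k + 2} Z"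
          using Z ex_bij_betw_nat_finite[of Z] by (auto simp: lessThan_atLeast0)
        show "\<exists>x\<in>Z. \<exists>y\<in>Z. x \<noteq> y \<and> \<not> covered H x y"
        proof (rule ccontr)
          assume all: "\<not> ?thesis"
          \<comment> \<open>Every edge of \<open>F2\<close> meets the core in just a pair, so
            pairwise covering of \<open>Z\<close> is all that the core embedding needs.\<close>
          have "has_copy H F2"
          proof (rule has_copy_of_core[OF F2 k1 H(1)])
            show "pos_codegree_ge k H (card (verts F2))"
              using d True unfolding pos_codegree_ge_def C_def
              by (meson add_leD1 order_trans)
            show "inj_on g {..<k + 2}" "g ` {..<k + 2} \<subseteq> verts H"
              using g Z by (auto simp: bij_betw_def)
            fix e assume "e \<in> edges F2"
            then obtain i j where ij: "i < k + 2" "j < k + 2" "i \<noteq> j" "e \<inter> {..<k + 2} = {i, j}"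
              using F2_core by blast
            have "g i \<in> Z" "g j \<in> Z" "g i \<noteq> g j"
              using g ij by (auto simp: bij_betw_def inj_on_def)
            then have "covered H (g i) (g j)" using all by blast
            then show "\<exists>h\<in>edges H. g ` (e \<inter> {..<k + 2}) \<subseteq> h"
              unfolding ij(4) covered_def by auto
          qed
          then show False using H(3) by (simp add: free_of_def)
        qed
      qed
    qed
    then have "real (k * k * ?d) \<le> real (2 * (k - 1) * n)" by (simp only: of_nat_le_iff)
    then have "real k * real k * real ?d \<le> 2 * (real k - 1) * real n"
      using k1 by (simp add: of_nat_diff)
    then show "real (ex_pos k n {F1, F2}) \<le> 2 * (real k - 1) / (real k * real k) * real n"
      unfolding ex using k1 by (simp add: field_simps)
  qed auto

  let ?x = "real k"
  have x: "?x \<ge> 3" using assms by simp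
  have "2 * (?x - 1) / (?x * ?x) < 5 / (?x + 8)"
  proof -
    \<comment> \<open>This product is the difference of the two sides after clearing
      denominators.\<close>
    have "0 < (3 * ?x - 8) * (?x - 2)" using x by (intro mult_pos_pos) auto
    then have "2 * (?x - 1) * (?x + 8) < 5 * (?x * ?x)" by (simp add: algebra_simps)
    then show ?thesis using x by (simp add: divide_simps)
  qed
  moreover have "2 * (?x - 1) / (?x * ?x) < 2 / (?x + 1)"
  proof -
    have "2 * (?x - 1) * (?x + 1) < 2 * (?x * ?x)" by (simp add: algebra_simps)
    then show ?thesis using x by (simp add: divide_simps)
  qed
  ultimately have "pos_codegree_density k {F1, F2}
      < min (pos_codegree_density k {F1}) (pos_codegree_density k {F2})"
    using upper lower1 lower2 by (simp add: add.commute)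
  moreover have "0 < pos_codegree_density k {F1, F2}"
    using lower x by (smt (verit) divide_pos_pos)
  ultimately show ?thesis using F1 F2 unfolding cored_def by blast
qed

end
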